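(* Let $A$ be a residuated lattice, $(\mathcal{L}(A),\lambda)$ its reticulation, and $m$ an infinite cardinal. Then $A$ is an $m$-co-Stone residuated lattice if and only if $\mathcal{L}(A)$ is an $m$-co-Stone lattice.
   Context: A residuated lattice is an algebra $(A,\vee,\wedge,\odot,\rightarrow,0,1)$ such that $(A,\vee,\wedge,0,1)$ is a bounded lattice, $(A,\odot,1)$ is a commutative monoid, and $a\leq b\rightarrow c$ iff $a\odot b\leq c$ for all $a,b,c\in A$. Write $a^n$ for the $n$-fold $\odot$-product of $a$. A reticulation of $A$ is a pair $(\mathcal{L}(A),\lambda)$ with $\mathcal{L}(A)$ a bounded distributive lattice and $\lambda:A\to\mathcal{L}(A)$ a surjective function such that for all $a,b\in A$: $\lambda(a\odot b)=\lambda(a)\wedge\lambda(b)$; $\lambda(a\vee b)=\lambda(a)\vee\lambda(b)$; $\lambda(0)=0$, $\lambda(1)=1$; and $\lambda(a)\leq\lambda(b)$ iff $a^n\leq b$ for some integer $n\geq 1$. A reticulation exists and is unique up to isomorphism (compatible with $\lambda$). A filter of a lattice is a non-empty upward closed subset closed under $\wedge$; a filter of a residuated lattice is a non-empty upward closed subset closed under $\odot$. $\langle x\rangle$ is the filter generated by $x$. For $M$ a bounded distributive lattice or a residuated lattice, $B(M)$ is the Boolean algebra of complemented elements of $M$, and $X^{\top}=\{a\in M\mid a\vee x=1\text{ for all }x\in X\}$ for $X\subseteq M$. $M$ is $m$-co-Stone iff for each non-empty $X\subseteq M$ with $|X|\leq m$ there exists $e\in B(M)$ with $X^{\top}=\langle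 e\rangle$ (this is one of several conditions known to be equivalent, any of which may be taken as the definition). *)

theory Defs
  imports Main
begin

unbundle lattice_syntax and cardinal_syntax

text \<open>
  The monoid operation is written \<open>*\<close>, so that \<open>a ^ n\<close> is its iterated product; the bounds of the
  lattice are \<open>\<bottom>\<close> and \<open>\<top>\<close>, and the monoid unit \<open>1\<close> is required to be the top element.
  The one-element algebra is allowed.
\<close>

class residuated_lattice = bounded_lattice + comm_monoid_mult +
  fixes residuum :: "'a \<Rightarrow> 'a \<Rightarrow> 'a"  (infixr "\<rightarrow>\<^sub>r" 60)
  assumes one_eq_top: "1 = \<top>"
    and residuation: "a \<le> b \<rightarrow>\<^sub>r c \<longleftrightarrow> a * b \<le> c"

definition is_reticulation ::
  "('a::residuated_lattice \<Rightarrow> 'b::{bounded_lattice, distrib_lattice}) \<Rightarrow> bool" where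
  "is_reticulation lam \<longleftrightarrow>
     surj lam \<and>
     (\<forall>a b. lam (a * b) = lam a \<sqinter> lam b) \<and>
     (\<forall>a b. lam (a \<squnion> b) = lam a \<squnion> lam b) \<and>
     lam \<bottom> = \<bottom> \<and> lam 1 = \<top> \<and>
     (\<forall>a b. lam a \<le> lam b \<longleftrightarrow> (\<exists>n\<ge>1. a ^ n \<le> b))"

definition lattice_filter :: "'a::lattice set \<Rightarrow> bool" where
  "lattice_filter F \<longleftrightarrow>
     F \<noteq> {} \<and> (\<forall>x\<in>F. \<forall>y. x \<le> y \<longrightarrow> y \<in> F) \<and> (\<forall>x\<in>F. \<forall>y\<in>F. x \<sqinter> y \<in> F)"

definition residuated_filter :: "'a::residuated_lattice set \<Rightarrow> bool" where
  "residuated_filter F \<longleftrightarrow>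
     F \<noteq> {} \<and> (\<forall>x\<in>F. \<forall>y. x \<le> y \<longrightarrow> y \<in> F) \<and> (\<forall>x\<in>F. \<forall>y\<in>F. x * y \<in> F)"

definition lattice_filter_gen :: "'a::lattice \<Rightarrow> 'a set" where
  "lattice_filter_gen x = \<Inter> {F. lattice_filter F \<and> x \<in> F}"

definition residuated_filter_gen :: "'a::residuated_lattice \<Rightarrow> 'a set" where
  "residuated_filter_gen x = \<Inter> {F. residuated_filter F \<and> x \<in> F}"

text \<open>
  Complements and co-annihilators only involve the lattice reduct, so the next two definitions
  serve residuated lattices as well.
\<close>

definition complemented_elements :: "'a::bounded_lattice set" where
  "complemented_elements = {e. \<exists>f. e \<squnion> f = \<top> \<and> e \<sqinter> f = \<bottom>}"

definition coannihilator :: "'a::bounded_lattice set \<Rightarrow> 'a set" where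
  "coannihilator X = {a. \<forall>x\<in>X. a \<squnion> x = \<top>}"

text \<open>
  A cardinal \<open>m\<close> is given by a cardinal order on some type, so that \<open>|X| \<le>o m\<close> says that \<open>X\<close> has
  cardinality at most \<open>m\<close>. The type underlying \<open>m\<close> is unrelated to that of \<open>X\<close>.
\<close>

definition co_stone_lattice ::
  "'c rel \<Rightarrow> 'a::{bounded_lattice, distrib_lattice} itself \<Rightarrow> bool" where
  "co_stone_lattice m _ \<longleftrightarrow>
     (\<forall>X :: 'a set. X \<noteq> {} \<and> |X| \<le>o m \<longrightarrow>
        (\<exists>e\<in>complemented_elements. coannihilator X = lattice_filter_gen e))"

definition co_stone_residuated_lattice ::
  "'c rel \<Rightarrow> 'a::residuated_lattice itself \<Rightarrow> bool" where
  "co_stone_residuated_lattice m _ \<longleftrightarrow>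
     (\<forall>X :: 'a set. X \<noteq> {} \<and> |X| \<le>o m \<longrightarrow>
        (\<exists>e\<in>complemented_elements. coannihilator X = residuated_filter_gen e))"

end

theory Submission
  imports Defs
begin

text \<open>
  The reticulation map \<open>\<lambda>\<close> satisfies \<open>\<lambda> a = \<top>\<close> iff \<open>a = 1\<close>, so co-annihilators in \<open>A\<close> are the
  preimages of co-annihilators in the reticulation, and principal filters of \<open>A\<close> are likewise the
  preimages of principal filters. Since \<open>\<lambda>\<close> is onto, it remains to lift complemented elements: if
  \<open>\<lambda> a\<close> and \<open>\<lambda> b\<close> are complementary then \<open>a\<^sup>n * b\<^sup>n = \<bottom>\<close> for some \<open>n \<ge> 1\<close>, while
  \<open>a\<^sup>n \<squnion> b\<^sup>n = \<top>\<close> because powers have the same image as their base; hence \<open>a\<^sup>n\<close> is a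
  complemented element above \<open>\<lambda> a\<close>.
\<close>

lemma residuated_mult_mono:
  fixes a b c d :: "'a::residuated_lattice"
  assumes "a \<le> b" "c \<le> d"
  shows "a * c \<le> b * d"
proof -
  have "b \<le> d \<rightarrow>\<^sub>r b * d" by (simp add: residuation)
  with assms(1) have "a * d \<le> b * d" by (metis order_trans residuation)
  moreover have "d \<le> a \<rightarrow>\<^sub>r a * d" by (simp add: residuation mult.commute)
  with assms(2) have "a * c \<le> a * d" by (metis order_trans residuation mult.commute)
  ultimately show ?thesis by (rule order_trans[rotated])
qed

text \<open>The unit is the top element, so replacing either factor by \<open>1\<close> can only
  enlarge the product.\<close>

lemma residuated_mult_le_inf: "a * b \<le> a \<sqinter> (b :: 'a::residuated_lattice)"
  using residuated_mult_mono[of a a b 1] residuated_mult_mono[of a 1 b b]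
  by (metis inf.boundedI mult_1 mult_1_right one_eq_top order_refl top_greatest)

text \<open>Multiplication by \<open>c\<close> is left adjoint to the residuum from
  \<open>c\<close>, hence preserves joins.\<close>

lemma residuated_sup_mult_distrib:
  fixes a b c :: "'a::residuated_lattice"
  shows "(a \<squnion> b) * c = a * c \<squnion> b * c"
proof (rule order_antisym)
  have "a \<le> c \<rightarrow>\<^sub>r (a * c \<squnion> b * c)" "b \<le> c \<rightarrow>\<^sub>r (a * c \<squnion> b * c)"
    by (simp_all add: residuation)
  then show "(a \<squnion> b) * c \<le> a * c \<squnion> b * c"
    by (metis le_supI residuation)
  show "a * c \<squnion> b * c \<le> (a \<squnion> b) * c"
    by (simp add: residuated_mult_mono)
qed

text \<open>Multiply \<open>a \<sqinter> b\<close> by \<open>1 = a \<squnion> b\<close> and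
  distribute: both resulting terms lie below \<open>a * b\<close>.\<close>

lemma residuated_inf_eq_mult:
  fixes a b :: "'a::residuated_lattice"
  assumes "a \<squnion> b = \<top>"
  shows "a \<sqinter> b = a * b"
proof (rule order_antisym)
  have "a \<sqinter> b = (a \<squnion> b) * (a \<sqinter> b)"
    by (simp add: assms flip: one_eq_top)
  also have "\<dots> = a * (a \<sqinter> b) \<squnion> b * (a \<sqinter> b)"
    by (rule residuated_sup_mult_distrib)
  also have "\<dots> \<le> a * b"
    using residuated_mult_mono[of a a "a \<sqinter> b" b] residuated_mult_mono[of b b "a \<sqinter> b" a]
    by (simp add: mult.commute)
  finally show "a \<sqinter> b \<le> a * b" .
qed (rule residuated_mult_le_inf)

lemma residuated_filter_upward: "residuated_filter F \<Longrightarrow> x \<in> F \<Longrightarrow> x \<le> y \<Longrightarrow> y \<in> F"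
  unfolding residuated_filter_def by blast

lemma residuated_filter_power:
  assumes "residuated_filter F" "x \<in> F" "n \<ge> 1"
  shows "x ^ n \<in> F"
  using assms(3)
proof (induction n rule: dec_induct)
  case base
  then show ?case using assms(2) by simp
next
  case (step n)
  then show ?case using assms(1,2) by (simp add: residuated_filter_def)
qed

lemma lattice_filter_gen_eq: "lattice_filter_gen x = {x..}"
proof
  have "lattice_filter {x..}"
    unfolding lattice_filter_def by auto
  then show "lattice_filter_gen x \<subseteq> {x..}"
    unfolding lattice_filter_gen_def by blast
  show "{x..} \<subseteq> lattice_filter_gen x"
    unfolding lattice_filter_gen_def lattice_filter_def by auto
qed

context
  fixes lam :: "'a::residuated_lattice \<Rightarrow> 'b::{bounded_lattice, distrib_lattice}"
  assumes ret: "is_reticulation lam"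
begin

lemma reticulation_surj: "surj lam"
  and reticulation_mult: "lam (a * b) = lam a \<sqinter> lam b"
  and reticulation_sup: "lam (a \<squnion> b) = lam a \<squnion> lam b"
  and reticulation_bot: "lam \<bottom> = \<bottom>"
  and reticulation_one: "lam 1 = \<top>"
  and reticulation_le_iff: "lam a \<le> lam b \<longleftrightarrow> (\<exists>n\<ge>1. a ^ n \<le> b)"
  using ret by (simp_all add: is_reticulation_def)

lemma reticulation_mono: "a \<le> b \<Longrightarrow> lam a \<le> lam b"
  by (metis reticulation_le_iff order_refl power_one_right)

text \<open>The axioms provide meets only as images of products; since
  \<open>a * b \<le> a \<sqinter> b\<close>, monotonicity gives the nontrivial inequality.\<close>

lemma reticulation_inf: "lam (a \<sqinter> b) = lam a \<sqinter> lam b"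
proof (rule order_antisym)
  show "lam (a \<sqinter> b) \<le> lam a \<sqinter> lam b"
    by (simp add: reticulation_mono)
  show "lam a \<sqinter> lam b \<le> lam (a \<sqinter> b)"
    using reticulation_mono[OF residuated_mult_le_inf] by (simp add: reticulation_mult)
qed

lemma reticulation_power: "n \<ge> 1 \<Longrightarrow> lam (a ^ n) = lam a"
  by (induction n rule: dec_induct) (simp_all add: reticulation_mult)

lemma reticulation_eq_top_iff: "lam a = \<top> \<longleftrightarrow> a = \<top>"
proof
  assume "lam a = \<top>"
  then have "lam 1 \<le> lam a" by simp
  \<comment> \<open>Every power of \<open>1\<close> is \<open>1\<close>, so the exponent
    disappears.\<close>
  then have "1 \<le> a" unfolding reticulation_le_iff by simp
  then show "a = \<top>" by (simp add: one_eq_top top_unique)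
next
  assume "a = \<top>"
  then show "lam a = \<top>" using reticulation_one by (simp add: one_eq_top)
qed

lemma coannihilator_eq_vimage:
  "coannihilator X = lam -` coannihilator (lam ` X)"
  by (auto simp: coannihilator_def reticulation_eq_top_iff simp flip: reticulation_sup)

text \<open>Both sides consist of the elements above some positive power of
  \<open>e\<close>.\<close>

lemma residuated_filter_gen_eq_vimage:
  "residuated_filter_gen e = lam -` lattice_filter_gen (lam e)"
proof
  \<comment> \<open>Products become meets under \<open>lam\<close>, so this preimage is itself a
    filter containing \<open>e\<close>.\<close>
  have "residuated_filter (lam -` {lam e..})"
    unfolding residuated_filter_def
    by (auto simp: reticulation_mult dest: reticulation_mono)
  then show "residuated_filter_gen e \<subseteq> lam -` lattice_filter_gen (lam e)"
    unfolding residuated_filter_gen_def lattice_filter_gen_eq by blast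
next
  show "lam -` lattice_filter_gen (lam e) \<subseteq> residuated_filter_gen e"
  proof
    fix a assume "a \<in> lam -` lattice_filter_gen (lam e)"
    then obtain n where "n \<ge> 1" "e ^ n \<le> a"
      by (auto simp: lattice_filter_gen_eq reticulation_le_iff)
    then show "a \<in> residuated_filter_gen e"
      unfolding residuated_filter_gen_def
      using residuated_filter_power[of _ e n] by (blast intro: residuated_filter_upward)
  qed
qed

lemma reticulation_complemented_elements:
  "lam ` complemented_elements = complemented_elements"
proof
  show "lam ` complemented_elements \<subseteq> complemented_elements"
  proof
    fix y assume "y \<in> lam ` complemented_elements"
    then obtain e f where "y = lam e" "e \<squnion> f = \<top>" "e \<sqinter> f = \<bottom>"
      by (auto simp: complemented_elements_def)
    then have "y \<squnion> lam f = \<top>" "y \<sqinter> lam f = \<bottom>"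
      by (simp_all add: reticulation_bot reticulation_eq_top_iff
          flip: reticulation_sup reticulation_inf)
    then show "y \<in> complemented_elements"
      by (auto simp: complemented_elements_def)
  qed
  show "complemented_elements \<subseteq> lam ` complemented_elements"
  proof
    fix y :: 'b assume "y \<in> complemented_elements"
    then obtain z where z: "y \<squnion> z = \<top>" "y \<sqinter> z = \<bottom>"
      by (auto simp: complemented_elements_def)
    obtain a b where ab: "y = lam a" "z = lam b"
      by (meson reticulation_surj surjD)
    have "lam (a * b) \<le> lam \<bottom>"
      using z(2) by (simp add: ab reticulation_mult)
    then obtain n where n: "n \<ge> 1" "(a * b) ^ n \<le> \<bottom>"
      unfolding reticulation_le_iff by blast
    have "lam (a ^ n \<squnion> b ^ n) = \<top>"
      using z(1) by (simp add: ab reticulation_sup reticulation_power[OF n(1)])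
    then have sup: "a ^ n \<squnion> b ^ n = \<top>"
      by (simp add: reticulation_eq_top_iff)
    \<comment> \<open>As the join is \<open>\<top>\<close>, the meet equals the product
      \<open>a ^ n * b ^ n\<close>, which is \<open>(a * b) ^ n\<close> by commutativity.\<close>
    have "a ^ n \<sqinter> b ^ n = \<bottom>"
      using n(2) by (simp add: residuated_inf_eq_mult[OF sup] power_mult_distrib bot_unique)
    with sup have "a ^ n \<in> complemented_elements"
      by (auto simp: complemented_elements_def)
    moreover have "y = lam (a ^ n)"
      by (simp add: ab reticulation_power[OF n(1)])
    ultimately show "y \<in> lam ` complemented_elements" by blast
  qed
qed

text \<open>Because \<open>lam\<close> is onto, sets with equal preimages are equal, and the
  complemented elements of the reticulation are exactly the images of those of the residuated
  lattice.\<close>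

lemma coannihilator_principal_iff:
  "(\<exists>e\<in>complemented_elements. coannihilator X = residuated_filter_gen e) \<longleftrightarrow>
   (\<exists>e\<in>complemented_elements. coannihilator (lam ` X) = lattice_filter_gen e)"
proof -
  have "coannihilator X = residuated_filter_gen e \<longleftrightarrow>
      coannihilator (lam ` X) = lattice_filter_gen (lam e)" for e
    unfolding coannihilator_eq_vimage residuated_filter_gen_eq_vimage
    by (metis reticulation_surj surj_image_vimage_eq)
  then show ?thesis
    by (simp flip: reticulation_complemented_elements)
qed

end

theorem proposition3p10:
  fixes lam :: "'a::residuated_lattice \<Rightarrow> 'b::{bounded_lattice, distrib_lattice}"
    and m :: "'c rel"
  assumes "is_reticulation lam"
    and "Card_order m" and "infinite (Field m)"
  shows "co_stone_residuated_lattice m TYPE('a) \<longleftrightarrow> co_stone_lattice m TYPE('b)"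
proof
  assume A: "co_stone_residuated_lattice m TYPE('a)"
  show "co_stone_lattice m TYPE('b)"
    unfolding co_stone_lattice_def
  proof (intro allI impI)
    fix Y :: "'b set" assume Y: "Y \<noteq> {} \<and> |Y| \<le>o m"
    \<comment> \<open>One preimage is chosen for each element of \<open>Y\<close>: the full preimage
      could have cardinality above \<open>m\<close>.\<close>
    define X where "X = inv lam ` Y"
    have "lam ` X = Y"
      unfolding X_def by (rule image_f_inv_f[OF reticulation_surj[OF assms(1)]])
    moreover have "|X| \<le>o m"
      unfolding X_def using Y card_of_image ordLeq_transitive by blast
    moreover have "X \<noteq> {}" using Y by (simp add: X_def)
    ultimately show "\<exists>e\<in>complemented_elements. coannihilator Y = lattice_filter_gen e"
      using A coannihilator_principal_iff[OF assms(1), of X]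
      by (auto simp: co_stone_residuated_lattice_def)
  qed
next
  assume L: "co_stone_lattice m TYPE('b)"
  show "co_stone_residuated_lattice m TYPE('a)"
    unfolding co_stone_residuated_lattice_def
  proof (intro allI impI)
    fix X :: "'a set" assume X: "X \<noteq> {} \<and> |X| \<le>o m"
    then have "|lam ` X| \<le>o m" using card_of_image ordLeq_transitive by blast
    with X L show "\<exists>e\<in>complemented_elements. coannihilator X = residuated_filter_gen e"
      unfolding coannihilator_principal_iff[OF assms(1)] co_stone_lattice_def by simp
  qed
qed

end
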